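(* Let $(X,d,E)$ and $(Y,\rho,F)$ be vector metric spaces and let $f:X\to Y$ be a function with graph $G_f=\{(x,f(x)):x\in X\}\subseteq X\times Y$. Equip $X\times Y$ with the $E\times F$-valued product vector metric $\pi$. Then the following statements hold. (a) The graph $G_f$ is $E\times F$-closed in $(X\times Y,\pi,E\times F)$ if and only if for every sequence $(x_n)$ in $X$ and all $x\in X$, $y\in Y$ with $x_n\xrightarrow{d,E}x$ and $f(x_n)\xrightarrow{\rho,F}y$, we have $y=f(x)$. (b) If $f$ is vectorial continuous, then $G_f$ is $E\times F$-closed. (c) If $f$ is vectorial continuous at $x_0\in X$, then the induced function $h:X\to G_f$ defined by $h(x)=(x,f(x))$ is vectorial continuous at $x_0$ (where $G_f$ carries the restriction of $\pi$).
   Context: In a Riesz space $E$, $a_n\downarrow 0$ means $(a_n)$ is a decreasing sequence in $E$ with $\inf_n a_n=0$. A vector metric ($E$-metric) on a non-empty set $X$, with $E$ a Riesz space, is a map $d:X\times X\to E$ such that (vm1) $d(x,y)=0$ if and only if $x=y$; (vm2) $d(x,y)\le d(x,z)+d(y,z)$ for all $x,y,z\in X$. The triple $(X,d,E)$ is a vector metric space. A sequence $(x_n)$ in $X$ is $E$-convergent to $x\in X$, written $x_n\xrightarrow{d,E}x$, if there is a sequence $(a_n)$ in $E$ with $a_n\downarrow 0$ and $d(x_n,x)\le a_n$ for all $n$. A subset $U\subseteq X$ is $E$-closed if $(x_n)\subseteq U$ and $x_n\xrightarrow{d,E}x$ imply $x\in U$. A function $f:(X,d,E)\to(Y,\rho,F)$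 is vectorial continuous at $x$ if $x_n\xrightarrow{d,E}x$ implies $f(x_n)\xrightarrow{\rho,F}f(x)$, and vectorial continuous if this holds at every $x\in X$. $E\times F$ is a Riesz space with coordinatewise ordering, and the product vector metric is $\pi((x_1,y_1),(x_2,y_2))=(d(x_1,x_2),\rho(y_1,y_2))$. *)

theory Defs
  imports
    "HOL-Analysis.Product_Vector"
    "HOL-Library.FuncSet"
    "HOL-Library.Lub_Glb"
    "HOL-Library.Product_Order"
begin

section \<open>Riesz spaces\<close>

class riesz_space = ordered_real_vector + lattice

instance real :: riesz_space ..

text \<open>The order on \<open>E \<times> F\<close> is the coordinatewise one from \<^theory>\<open>HOL-Library.Product_Order\<close>.\<close>

instance prod :: (riesz_space, riesz_space) riesz_space
proof
  fix x y z :: "'a \<times> 'b" and a b :: real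
  show "x \<le> y \<Longrightarrow> z + x \<le> z + y"
    by (simp add: less_eq_prod_def)
  show "x \<le> y \<Longrightarrow> 0 \<le> a \<Longrightarrow> a *\<^sub>R x \<le> a *\<^sub>R y"
    by (simp add: less_eq_prod_def scaleR_left_mono)
  show "a \<le> b \<Longrightarrow> 0 \<le> x \<Longrightarrow> a *\<^sub>R x \<le> b *\<^sub>R x"
    by (simp add: less_eq_prod_def scaleR_right_mono)
qed

definition decreases_to_zero :: "(nat \<Rightarrow> 'e::riesz_space) \<Rightarrow> bool"
  where "decreases_to_zero a \<longleftrightarrow> decseq a \<and> isGlb UNIV (range a) 0"


section \<open>Vector metric spaces\<close>

text \<open>
  The underlying set of a space is an explicit carrier; the values of a metric outside its
  carrier are irrelevant, so restricting a metric to a subset amounts to shrinking the carrier.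
\<close>

locale vector_metric_space =
  fixes X :: "'a set" and d :: "'a \<Rightarrow> 'a \<Rightarrow> 'e::riesz_space"
  assumes nonempty: "X \<noteq> {}"
    and vm1: "\<lbrakk>x \<in> X; y \<in> X\<rbrakk> \<Longrightarrow> d x y = 0 \<longleftrightarrow> x = y"
    and vm2: "\<lbrakk>x \<in> X; y \<in> X; z \<in> X\<rbrakk> \<Longrightarrow> d x y \<le> d x z + d y z"

definition E_converges :: "'a set \<Rightarrow> ('a \<Rightarrow> 'a \<Rightarrow> 'e::riesz_space) \<Rightarrow> (nat \<Rightarrow> 'a) \<Rightarrow> 'a \<Rightarrow> bool"
  where "E_converges X d xs x \<longleftrightarrow>
    range xs \<subseteq> X \<and> x \<in> X \<and> (\<exists>a. decreases_to_zero a \<and> (\<forall>n. d (xs n) x \<le> a n))"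

definition E_closed :: "'a set \<Rightarrow> ('a \<Rightarrow> 'a \<Rightarrow> 'e::riesz_space) \<Rightarrow> 'a set \<Rightarrow> bool"
  where "E_closed X d U \<longleftrightarrow>
    U \<subseteq> X \<and> (\<forall>xs x. range xs \<subseteq> U \<and> E_converges X d xs x \<longrightarrow> x \<in> U)"

definition vectorial_continuous_at ::
    "'a set \<Rightarrow> ('a \<Rightarrow> 'a \<Rightarrow> 'e::riesz_space) \<Rightarrow> 'b set \<Rightarrow> ('b \<Rightarrow> 'b \<Rightarrow> 'f::riesz_space) \<Rightarrow>
     ('a \<Rightarrow> 'b) \<Rightarrow> 'a \<Rightarrow> bool"
  where "vectorial_continuous_at X d Y \<rho> f x \<longleftrightarrow>
    (\<forall>xs. E_converges X d xs x \<longrightarrow> E_converges Y \<rho> (\<lambda>n. f (xs n)) (f x))"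

definition vectorial_continuous ::
    "'a set \<Rightarrow> ('a \<Rightarrow> 'a \<Rightarrow> 'e::riesz_space) \<Rightarrow> 'b set \<Rightarrow> ('b \<Rightarrow> 'b \<Rightarrow> 'f::riesz_space) \<Rightarrow>
     ('a \<Rightarrow> 'b) \<Rightarrow> bool"
  where "vectorial_continuous X d Y \<rho> f \<longleftrightarrow> (\<forall>x\<in>X. vectorial_continuous_at X d Y \<rho> f x)"


section \<open>Products and graphs\<close>

definition product_metric ::
    "('a \<Rightarrow> 'a \<Rightarrow> 'e) \<Rightarrow> ('b \<Rightarrow> 'b \<Rightarrow> 'f) \<Rightarrow> 'a \<times> 'b \<Rightarrow> 'a \<times> 'b \<Rightarrow> 'e \<times> 'f"
  where "product_metric d \<rho> p q = (d (fst p) (fst q), \<rho> (snd p) (snd q))"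

definition fun_graph :: "'a set \<Rightarrow> ('a \<Rightarrow> 'b) \<Rightarrow> ('a \<times> 'b) set"
  where "fun_graph X f = {(x, f x) | x. x \<in> X}"

lemma vector_metric_space_product:
  assumes "vector_metric_space X d" and "vector_metric_space Y \<rho>"
  shows "vector_metric_space (X \<times> Y) (product_metric d \<rho>)"
proof -
  interpret X: vector_metric_space X d by fact
  interpret Y: vector_metric_space Y \<rho> by fact
  show ?thesis
    using X.nonempty Y.nonempty X.vm1 Y.vm1 X.vm2 Y.vm2
    by unfold_locales (auto simp: product_metric_def zero_prod_def less_eq_prod_def)
qed

lemma vector_metric_space_subset:
  assumes "vector_metric_space X d" and "U \<subseteq> X" and "U \<noteq> {}"
  shows "vector_metric_space U d"
proof -
  interpret vector_metric_space X d by fact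
  show ?thesis
    using assms(2,3) vm1 vm2 by unfold_locales (auto simp: subset_iff)
qed

end

theory Submission
  imports Defs
begin

text \<open>Everything reduces to one fact: E-convergence in the product is coordinatewise
  (\<open>E_converges_product_iff\<close>), because a sequence in \<open>E \<times> F\<close>
  decreases to zero exactly when both of its coordinates do
  (\<open>decreases_to_zero_Pair_iff\<close>). A sequence in the graph has the form
  \<open>(xs n, f (xs n))\<close>, and its limits are the pairs \<open>(x, y)\<close> with
  \<open>xs\<close> tending to \<open>x\<close> and \<open>f (xs n)\<close> to \<open>y\<close>;
  such a pair lies on the graph iff \<open>y = f x\<close>. This is (a). For (b), continuity makes
  \<open>f x\<close> a second limit of \<open>f (xs n)\<close>, and limits are unique
  (\<open>E_converges_unique\<close>). For (c), both coordinates of \<open>h (xs n)\<close>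
  converge, and restricting the metric to the graph preserves this.\<close>

lemma decreases_to_zero_iff:
  "decreases_to_zero a \<longleftrightarrow>
    decseq a \<and> (\<forall>n. 0 \<le> a n) \<and> (\<forall>c. (\<forall>n. c \<le> a n) \<longrightarrow> c \<le> 0)"
  by (simp add: decreases_to_zero_def isGlb_def isLb_def greatestP_def setge_def setle_def)

lemma decreases_to_zero_Pair_iff:
  fixes a :: "nat \<Rightarrow> 'e::riesz_space" and b :: "nat \<Rightarrow> 'f::riesz_space"
  shows "decreases_to_zero (\<lambda>n. (a n, b n)) \<longleftrightarrow> decreases_to_zero a \<and> decreases_to_zero b"
    (is "?ab \<longleftrightarrow> ?a \<and> ?b")
proof (intro iffI conjI)
  assume ab: ?ab
  have pos: "0 \<le> a n" "0 \<le> b n" for n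
    using ab by (auto simp: decreases_to_zero_iff zero_prod_def)
  have glb: "u \<le> 0 \<and> v \<le> 0" if "\<forall>n. u \<le> a n \<and> v \<le> b n" for u v
  proof -
    have "(\<forall>n. (u, v) \<le> (a n, b n)) \<longrightarrow> (u, v) \<le> 0"
      using ab unfolding decreases_to_zero_iff by blast
    with that show ?thesis
      by (simp add: zero_prod_def)
  qed
  have dec: "decseq a" "decseq b"
    using ab by (auto simp: decreases_to_zero_iff decseq_def)
  \<comment> \<open>A lower bound \<open>u\<close> of \<open>a\<close> is paired with
    \<open>0\<close>, which bounds \<open>b\<close> from below, to give a lower bound of the pairs;
    \<open>b\<close> is treated symmetrically.\<close>
  show ?a
    unfolding decreases_to_zero_iff using dec pos glb[where v = 0] by blast
  show ?b
    unfolding decreases_to_zero_iff using dec pos glb[where u = 0] by blast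
next
  assume "?a \<and> ?b"
  then show ?ab
    by (auto simp: decreases_to_zero_iff decseq_def zero_prod_def)
qed

lemma decreases_to_zero_add:
  assumes a: "decreases_to_zero a" and b: "decreases_to_zero b"
  shows "decreases_to_zero (\<lambda>n. a n + b n)"
  unfolding decreases_to_zero_iff
proof (intro conjI allI impI)
  show "decseq (\<lambda>n. a n + b n)"
    using a b by (auto simp: decreases_to_zero_iff decseq_def intro: add_mono)
  show "0 \<le> a n + b n" for n
    using a b by (auto simp: decreases_to_zero_iff)
next
  fix c assume c: "\<forall>n. c \<le> a n + b n"
  \<comment> \<open>Both sequences decrease, so evaluating at \<open>max m n\<close> decouples the
    two indices. The infimum can then be taken over \<open>m\<close> with \<open>n\<close> fixed,
    and over \<open>n\<close> afterwards.\<close>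
  have "c - b n \<le> a m" for m n
  proof -
    have "c \<le> a (max m n) + b (max m n)"
      using c by blast
    also have "\<dots> \<le> a m + b n"
      using a b by (intro add_mono) (auto simp: decreases_to_zero_iff decseq_def)
    finally show ?thesis
      by (simp add: diff_le_eq)
  qed
  then have "c - b n \<le> 0" for n
    using a unfolding decreases_to_zero_iff by blast
  then show "c \<le> 0"
    using b by (simp add: decreases_to_zero_iff)
qed

text \<open>The order on \<open>E \<times> F\<close> is coordinatewise, so a dominating sequence for
  the pairs splits into one for each factor, and two dominating sequences can be paired.\<close>

lemma E_converges_product_iff:
  "E_converges (X \<times> Y) (product_metric d \<rho>) (\<lambda>n. (xs n, ys n)) (x, y) \<longleftrightarrow>
    E_converges X d xs x \<and> E_converges Y \<rho> ys y" (is "?L \<longleftrightarrow> ?R")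
proof
  assume ?L
  then obtain a where
    mem: "range xs \<subseteq> X" "range ys \<subseteq> Y" "x \<in> X" "y \<in> Y" and a: "decreases_to_zero a"
    and le: "\<And>n. (d (xs n) x, \<rho> (ys n) y) \<le> a n"
    by (auto simp: E_converges_def product_metric_def)
  have "decreases_to_zero (fst \<circ> a)" "decreases_to_zero (snd \<circ> a)"
    using a decreases_to_zero_Pair_iff[of "fst \<circ> a" "snd \<circ> a"] by simp_all
  moreover have "\<forall>n. d (xs n) x \<le> (fst \<circ> a) n" "\<forall>n. \<rho> (ys n) y \<le> (snd \<circ> a) n"
    using le by (simp_all add: less_eq_prod_def)
  ultimately show ?R
    using mem unfolding E_converges_def by blast
next
  assume ?R
  then obtain a b where
    mem: "range xs \<subseteq> X" "range ys \<subseteq> Y" "x \<in> X" "y \<in> Y"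
    and ab: "decreases_to_zero a" "decreases_to_zero b"
    and le: "\<And>n. d (xs n) x \<le> a n" "\<And>n. \<rho> (ys n) y \<le> b n"
    by (auto simp: E_converges_def)
  have "decreases_to_zero (\<lambda>n. (a n, b n))"
    using ab by (simp add: decreases_to_zero_Pair_iff)
  moreover have "\<forall>n. product_metric d \<rho> (xs n, ys n) (x, y) \<le> (a n, b n)"
    using le by (simp add: product_metric_def)
  ultimately show ?L
    using mem unfolding E_converges_def by blast
qed

text \<open>The dominating sequence lives in the Riesz space, so shrinking the carrier affects only
  the membership conditions.\<close>

lemma E_converges_subset_iff:
  assumes "U \<subseteq> X"
  shows "E_converges U d xs x \<longleftrightarrow> range xs \<subseteq> U \<and> x \<in> U \<and> E_converges X d xs x"
  using assms by (auto simp: E_converges_def)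

context vector_metric_space
begin

text \<open>Symmetry is not an axiom: it comes from \<open>vm2\<close> with the third point equal to
  the first, where \<open>d x x = 0\<close>.\<close>

lemma metric_commute:
  assumes "x \<in> X" "y \<in> X"
  shows "d x y = d y x"
proof (rule order.antisym)
  show "d x y \<le> d y x"
    using vm2[of x y x] vm1[of x x] assms by simp
  show "d y x \<le> d x y"
    using vm2[of y x y] vm1[of y y] assms by simp
qed

text \<open>Applying \<open>vm2\<close> to \<open>x\<close>, \<open>x\<close> and \<open>y\<close>
  gives \<open>0 \<le> 2 d x y\<close>, and scaling by one half preserves the order.\<close>

lemma metric_nonneg:
  assumes "x \<in> X" "y \<in> X"
  shows "0 \<le> d x y"
proof -
  have "0 \<le> d x y + d x y"
    using vm2[of x x y] vm1[of x x] assms by simp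
  then have "0 \<le> (1/2) *\<^sub>R (d x y + d x y)"
    by (intro scaleR_nonneg_nonneg) simp_all
  then show ?thesis
    by (simp only: scaleR_half_double)
qed

text \<open>By the triangle inequality \<open>d x y\<close> is a lower bound of the sum of two
  sequences decreasing to zero.\<close>

lemma E_converges_unique:
  assumes "E_converges X d xs x" "E_converges X d xs y"
  shows "x = y"
proof -
  obtain a b where mem: "range xs \<subseteq> X" "x \<in> X" "y \<in> X"
    and ab: "decreases_to_zero a" "decreases_to_zero b"
    and le: "\<And>n. d (xs n) x \<le> a n" "\<And>n. d (xs n) y \<le> b n"
    using assms by (auto simp: E_converges_def)
  have "d x y \<le> a n + b n" for n
  proof -
    have n: "xs n \<in> X"
      using mem by auto
    have "d x y \<le> d (xs n) x + d (xs n) y"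
      using vm2[of x y "xs n"] mem n metric_commute by simp
    also have "\<dots> \<le> a n + b n"
      using le by (intro add_mono)
    finally show ?thesis .
  qed
  then have "d x y \<le> 0"
    using decreases_to_zero_add[OF ab] by (simp add: decreases_to_zero_iff)
  then have "d x y = 0"
    using metric_nonneg[OF mem(2,3)] by (rule order.antisym)
  then show ?thesis
    using vm1 mem by simp
qed

end

lemma E_closed_fun_graph_iff:
  assumes f: "f \<in> X \<rightarrow> Y"
  shows "E_closed (X \<times> Y) (product_metric d \<rho>) (fun_graph X f) \<longleftrightarrow>
    (\<forall>xs x y. E_converges X d xs x \<and> E_converges Y \<rho> (\<lambda>n. f (xs n)) y \<longrightarrow> y = f x)"
    (is "?L \<longleftrightarrow> ?R")
proof
  assume L: ?L
  show ?R
  proof (intro allI impI)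
    fix xs x y assume conv: "E_converges X d xs x \<and> E_converges Y \<rho> (\<lambda>n. f (xs n)) y"
    then have "range (\<lambda>n. (xs n, f (xs n))) \<subseteq> fun_graph X f"
      by (auto simp: E_converges_def fun_graph_def)
    moreover have "E_converges (X \<times> Y) (product_metric d \<rho>) (\<lambda>n. (xs n, f (xs n))) (x, y)"
      using conv by (simp only: E_converges_product_iff)
    ultimately have "(x, y) \<in> fun_graph X f"
      using L unfolding E_closed_def by blast
    then show "y = f x"
      by (simp add: fun_graph_def)
  qed
next
  assume R: ?R
  show ?L
    unfolding E_closed_def
  proof (intro conjI allI impI)
    show "fun_graph X f \<subseteq> X \<times> Y"
      using f by (auto simp: fun_graph_def)
  next
    fix ps p
    assume ps: "range ps \<subseteq> fun_graph X f \<and> E_converges (X \<times> Y) (product_metric d \<rho>) ps p"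
    define xs where "xs = fst \<circ> ps"
    \<comment> \<open>A point of the graph is determined by its first coordinate.\<close>
    have "ps n = (xs n, f (xs n))" for n
    proof -
      have "ps n \<in> fun_graph X f"
        using ps by auto
      then show ?thesis
        by (auto simp: fun_graph_def xs_def)
    qed
    then have "ps = (\<lambda>n. (xs n, f (xs n)))"
      by (rule ext)
    then have conv: "E_converges X d xs (fst p) \<and> E_converges Y \<rho> (\<lambda>n. f (xs n)) (snd p)"
      using ps E_converges_product_iff[of X Y d \<rho> xs "\<lambda>n. f (xs n)" "fst p" "snd p"] by simp
    then have "snd p = f (fst p)"
      using R by blast
    moreover have "fst p \<in> X"
      using conv by (simp add: E_converges_def)
    ultimately show "p \<in> fun_graph X f"
      by (cases p) (simp add: fun_graph_def)
  qed
qed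

theorem corollary3:
  fixes X :: "'a set" and d :: "'a \<Rightarrow> 'a \<Rightarrow> 'e::riesz_space"
    and Y :: "'b set" and \<rho> :: "'b \<Rightarrow> 'b \<Rightarrow> 'f::riesz_space"
    and f :: "'a \<Rightarrow> 'b"
  assumes "vector_metric_space X d"
    and "vector_metric_space Y \<rho>"
    and "f \<in> X \<rightarrow> Y"
  shows "(E_closed (X \<times> Y) (product_metric d \<rho>) (fun_graph X f) \<longleftrightarrow>
      (\<forall>xs. range xs \<subseteq> X \<longrightarrow>
        (\<forall>x\<in>X. \<forall>y\<in>Y. E_converges X d xs x \<and> E_converges Y \<rho> (\<lambda>n. f (xs n)) y \<longrightarrow> y = f x)))
    \<and> (vectorial_continuous X d Y \<rho> f \<longrightarrow>
      E_closed (X \<times> Y) (product_metric d \<rho>) (fun_graph X f))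
    \<and> (\<forall>x\<^sub>0\<in>X. vectorial_continuous_at X d Y \<rho> f x\<^sub>0 \<longrightarrow>
      vectorial_continuous_at X d (fun_graph X f) (product_metric d \<rho>) (\<lambda>x. (x, f x)) x\<^sub>0)"
proof (intro conjI impI ballI)
  show "E_closed (X \<times> Y) (product_metric d \<rho>) (fun_graph X f) \<longleftrightarrow>
      (\<forall>xs. range xs \<subseteq> X \<longrightarrow>
        (\<forall>x\<in>X. \<forall>y\<in>Y. E_converges X d xs x \<and> E_converges Y \<rho> (\<lambda>n. f (xs n)) y \<longrightarrow> y = f x))"
    \<comment> \<open>Convergence already entails the carrier memberships, so bounded and unbounded
      quantifiers agree.\<close>
    unfolding E_closed_fun_graph_iff[OF assms(3)] by (auto simp: E_converges_def)
next
  assume "vectorial_continuous X d Y \<rho> f"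
  have "E_converges Y \<rho> (\<lambda>n. f (xs n)) (f x)" if "E_converges X d xs x" for xs x
  proof -
    have "x \<in> X"
      using that by (simp add: E_converges_def)
    with \<open>vectorial_continuous X d Y \<rho> f\<close> that show ?thesis
      by (simp add: vectorial_continuous_def vectorial_continuous_at_def)
  qed
  then show "E_closed (X \<times> Y) (product_metric d \<rho>) (fun_graph X f)"
    unfolding E_closed_fun_graph_iff[OF assms(3)]
    \<comment> \<open>Both \<open>y\<close> and \<open>f x\<close> are limits of
      \<open>f (xs n)\<close> in \<open>Y\<close>.\<close>
    using vector_metric_space.E_converges_unique[OF assms(2)] by blast
next
  fix x\<^sub>0 assume cont: "vectorial_continuous_at X d Y \<rho> f x\<^sub>0"
  show "vectorial_continuous_at X d (fun_graph X f) (product_metric d \<rho>) (\<lambda>x. (x, f x)) x\<^sub>0"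
    unfolding vectorial_continuous_at_def
  proof (intro allI impI)
    fix xs assume conv: "E_converges X d xs x\<^sub>0"
    then have "E_converges (X \<times> Y) (product_metric d \<rho>) (\<lambda>n. (xs n, f (xs n))) (x\<^sub>0, f x\<^sub>0)"
      using cont by (simp add: E_converges_product_iff vectorial_continuous_at_def)
    moreover have "fun_graph X f \<subseteq> X \<times> Y"
      using assms(3) by (auto simp: fun_graph_def)
    moreover have "range (\<lambda>n. (xs n, f (xs n))) \<subseteq> fun_graph X f" "(x\<^sub>0, f x\<^sub>0) \<in> fun_graph X f"
      using conv by (auto simp: E_converges_def fun_graph_def)
    ultimately show "E_converges (fun_graph X f) (product_metric d \<rho>)
        (\<lambda>n. (xs n, f (xs n))) (x\<^sub>0, f x\<^sub>0)"
      by (simp add: E_converges_subset_iff[of "fun_graph X f" "X \<times> Y"])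
  qed
qed

end
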